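(* Let $\mathbb{K}$ be a field, $R=\mathbb{K}[X_1,\ldots,X_n]$, and let $I\subset R$ be a monomial ideal. Then for all integers $m\ge 2$, the index of stability of $I$ and the index of stability of $I^{[m]}$ are the same.
   Context: For $f\in R$ and a positive integer $m$, $f^{[m]}:=f(X_1^m,\ldots,X_n^m)$, and the $m$-th square power of an ideal $I\subset R$ is the ideal $I^{[m]}:=\langle f^{[m]} : f\in I\rangle$ of $R$. The index of stability of an ideal $J\subset R$ is the least positive integer $s_0$ such that $\operatorname{Ass}(R/J^s)=\operatorname{Ass}(R/J^{s_0})$ for all $s\ge s_0$ (such an integer exists by a theorem of Brodmann). *)

theory Defs
  imports
    "HOL-Library.Poly_Mapping"
    "HOL-Algebra.Module"
    "HOL-Algebra.QuotRing"
    "HOL-Algebra.Ideal_Product"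
    "HOL-Algebra.Algebraic_Closure_Type"
begin

section \<open>Associated primes and the index of stability\<close>

text \<open>The ring \<open>R/J\<close> as an \<open>R\<close>-module, with \<open>r \<cdot> (J + x) = J + r x\<close>.\<close>

definition quotient_module :: "('a, 'b) ring_scheme \<Rightarrow> 'a set \<Rightarrow> ('a, 'a set) module"
  where "quotient_module R J =
    \<lparr>carrier = carrier (R Quot J),
     monoid.mult = monoid.mult (R Quot J),
     one = one (R Quot J),
     ring.zero = ring.zero (R Quot J),
     add = add (R Quot J),
     module.smult = (\<lambda>r x. (J +>\<^bsub>R\<^esub> r) \<otimes>\<^bsub>R Quot J\<^esub> x)\<rparr>"

definition annihilator ::
    "('a, 'c) ring_scheme \<Rightarrow> ('a, 'b, 'd) module_scheme \<Rightarrow> 'b \<Rightarrow> 'a set"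
  where "annihilator R M x = {r \<in> carrier R. r \<odot>\<^bsub>M\<^esub> x = \<zero>\<^bsub>M\<^esub>}"

definition associated_primes ::
    "('a, 'c) ring_scheme \<Rightarrow> ('a, 'b, 'd) module_scheme \<Rightarrow> 'a set set"
  where "associated_primes R M =
    {P. primeideal P R \<and> (\<exists>x \<in> carrier M. P = annihilator R M x)}"

text \<open>
  The powers of an ideal are its powers in the semiring \<^const>\<open>ideals_set\<close> of all ideals.
  A least element exists in a Noetherian ring, by Brodmann's theorem; otherwise the value may be
  unspecified.
\<close>

definition index_of_stability :: "('a, 'b) ring_scheme \<Rightarrow> 'a set \<Rightarrow> nat"
  where "index_of_stability R J =
    (LEAST s\<^sub>0. 0 < s\<^sub>0 \<and>
       (\<forall>s \<ge> s\<^sub>0. associated_primes R (quotient_module R (J [^]\<^bsub>ideals_set R\<^esub> s)) =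
                 associated_primes R (quotient_module R (J [^]\<^bsub>ideals_set R\<^esub> s\<^sub>0))))"

lemma (in cring) quotient_module_is_module:
  assumes "ideal J R"
  shows "module R (quotient_module R J)"
proof -
  interpret J: ideal J R by fact
  interpret Q: cring "R Quot J" by (rule J.quotient_is_cring) (rule is_cring)
  interpret h: ring_hom_cring R "R Quot J" "(+>\<^bsub>R\<^esub>) J"
    by (rule J.rcos_ring_hom_cring) (rule is_cring)
  note sel = quotient_module_def
  show ?thesis
  proof (rule moduleI)
    show "abelian_group (quotient_module R J)"
    proof (rule abelian_groupI)
      fix x assume "x \<in> carrier (quotient_module R J)"
      then show "\<exists>y \<in> carrier (quotient_module R J).
          y \<oplus>\<^bsub>quotient_module R J\<^esub> x = \<zero>\<^bsub>quotient_module R J\<^esub>"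
        using Q.l_neg Q.a_inv_closed by (auto simp: sel)
    qed (simp_all add: sel Q.a_ac)
  qed (auto simp: sel is_cring Q.l_distr Q.r_distr Q.m_assoc
         h.hom_add h.hom_mult h.hom_closed Q.l_one[unfolded h.hom_one[symmetric]])
qed


section \<open>Polynomial rings in finitely many variables\<close>

text \<open>
  The variables are indexed by a finite type \<open>'n\<close>. A polynomial maps each exponent vector in
  \<open>'n \<Rightarrow>\<^sub>0 nat\<close> to its coefficient; the product on \<^type>\<open>poly_mapping\<close> is convolution.
\<close>

type_synonym ('n, 'k) mpoly = "('n \<Rightarrow>\<^sub>0 nat) \<Rightarrow>\<^sub>0 'k"

abbreviation mpoly_ring :: "('n, 'k :: comm_ring_1) mpoly ring"
  where "mpoly_ring \<equiv> ring_of_type_algebra"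

definition mpoly_const :: "'k \<Rightarrow> ('n, 'k :: comm_ring_1) mpoly"
  where "mpoly_const c = Poly_Mapping.single 0 c"

definition mpoly_var :: "'n \<Rightarrow> ('n, 'k :: comm_ring_1) mpoly"
  where "mpoly_var i = Poly_Mapping.single (Poly_Mapping.single i 1) 1"

definition mpoly_monomial :: "('n \<Rightarrow>\<^sub>0 nat) \<Rightarrow> ('n :: finite, 'k :: comm_ring_1) mpoly"
  where "mpoly_monomial a = (\<Prod>i\<in>UNIV. mpoly_var i ^ Poly_Mapping.lookup a i)"

text \<open>The substitution \<open>f(g\<^sub>1, \<dots>, g\<^sub>n)\<close>.\<close>

definition mpoly_subst ::
    "('n \<Rightarrow> ('n, 'k) mpoly) \<Rightarrow> ('n, 'k) mpoly \<Rightarrow> ('n :: finite, 'k :: comm_ring_1) mpoly"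
  where "mpoly_subst g f =
    (\<Sum>a\<in>Poly_Mapping.keys f.
       mpoly_const (Poly_Mapping.lookup f a) * (\<Prod>i\<in>UNIV. g i ^ Poly_Mapping.lookup a i))"

definition monomial_ideal :: "('n :: finite, 'k :: comm_ring_1) mpoly set \<Rightarrow> bool"
  where "monomial_ideal I \<longleftrightarrow> (\<exists>A. I = Idl\<^bsub>mpoly_ring\<^esub> (mpoly_monomial ` A))"

definition square_power_poly ::
    "nat \<Rightarrow> ('n, 'k) mpoly \<Rightarrow> ('n :: finite, 'k :: comm_ring_1) mpoly"
  where "square_power_poly m f = mpoly_subst (\<lambda>i. mpoly_var i ^ m) f"

definition square_power_ideal ::
    "nat \<Rightarrow> ('n, 'k) mpoly set \<Rightarrow> ('n :: finite, 'k :: comm_ring_1) mpoly set"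
  where "square_power_ideal m I = Idl\<^bsub>mpoly_ring\<^esub> (square_power_poly m ` I)"

lemma mpoly_var_power:
  "(mpoly_var i :: ('n, 'k :: comm_ring_1) mpoly) ^ k =
     Poly_Mapping.single (Poly_Mapping.single i k) 1"
  by (induction k) (simp_all add: mpoly_var_def mult_single flip: single_add)

lemma mpoly_monomial_eq_single:
  "(mpoly_monomial a :: ('n :: finite, 'k :: comm_ring_1) mpoly) = Poly_Mapping.single a 1"
proof -
  have prod: "(\<Prod>i\<in>S. Poly_Mapping.single (Poly_Mapping.single i (Poly_Mapping.lookup a i)) 1) =
      (Poly_Mapping.single (\<Sum>i\<in>S. Poly_Mapping.single i (Poly_Mapping.lookup a i)) 1
        :: ('n, 'k) mpoly)" for S
    by (induction S rule: infinite_finite_induct) (simp_all add: mult_single)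
  have "(\<Sum>i\<in>UNIV. Poly_Mapping.single i (Poly_Mapping.lookup a i)) = a"
    by (rule poly_mapping_eqI) (simp add: lookup_sum lookup_single when_def)
  with prod[of UNIV] show ?thesis
    by (simp add: mpoly_monomial_def mpoly_var_power)
qed

end

theory Submission
  imports Defs
begin

text \<open>
  A monomial ideal \<open>J\<close> is determined by its upward closed set \<open>U\<close> of exponents, and the
  exponents of its \<open>m\<close>-th square power form the preimage of \<open>U\<close> under componentwise division
  by \<open>m\<close>, so square powers commute with ordinary powers. An associated prime of \<open>R/J\<close> is
  generated by the variables in a set \<open>S\<close> and equals \<open>(J : X^u)\<close> for some monomial. If \<open>u\<close>
  is such an exponent for \<open>J\<close>, then \<open>m u\<close> increased by \<open>m - 1\<close> on \<open>S\<close> is one for the square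
  power, with the same \<open>S\<close>; conversely \<open>v\<close> gives \<open>v div m\<close>. So all powers of \<open>I\<close> and of its
  square power have the same associated primes, and Brodmann's theorem is not involved.
\<close>

section \<open>Coefficients of products\<close>

lemma keys_diff_single:
  fixes f :: "'a \<Rightarrow>\<^sub>0 'b :: ab_group_add"
  shows "Poly_Mapping.keys (f - Poly_Mapping.single a (Poly_Mapping.lookup f a)) =
    Poly_Mapping.keys f - {a}"
  by (auto simp: in_keys_iff lookup_minus lookup_single when_def split: if_splits)

text \<open>Split off the term of \<open>f\<close> at \<open>a\<close> and the term of
  \<open>g\<close> at \<open>b\<close>. By the uniqueness hypothesis, only the product of these two
  terms can contribute at \<open>a + b\<close>.\<close>

lemma lookup_mult_unique:
  fixes f g :: "'a :: comm_monoid_add \<Rightarrow>\<^sub>0 'b :: comm_ring_1"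
  assumes "\<And>a' b'. a' \<in> Poly_Mapping.keys f \<Longrightarrow> b' \<in> Poly_Mapping.keys g \<Longrightarrow> a' + b' = a + b \<Longrightarrow> a' = a \<and> b' = b"
  shows "Poly_Mapping.lookup (f * g) (a + b) = Poly_Mapping.lookup f a * Poly_Mapping.lookup g b"
proof -
  define s where "s = Poly_Mapping.single a (Poly_Mapping.lookup f a)"
  define t where "t = Poly_Mapping.single b (Poly_Mapping.lookup g b)"
  have "f * g = s * t + s * (g - t) + (f - s) * g"
    by (simp add: algebra_simps)
  moreover have "a + b \<notin> Poly_Mapping.keys (s * (g - t))"
  proof
    assume "a + b \<in> Poly_Mapping.keys (s * (g - t))"
    then obtain a' b' where "a' \<in> Poly_Mapping.keys s" "b' \<in> Poly_Mapping.keys (g - t)" "a' + b' = a + b"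
      using keys_mult by fastforce
    then show False
      using assms[of a' b'] unfolding s_def t_def keys_diff_single
      by (auto simp: in_keys_iff split: if_splits)
  qed
  moreover have "a + b \<notin> Poly_Mapping.keys ((f - s) * g)"
  proof
    assume "a + b \<in> Poly_Mapping.keys ((f - s) * g)"
    then obtain a' b' where "a' \<in> Poly_Mapping.keys (f - s)" "b' \<in> Poly_Mapping.keys g" "a' + b' = a + b"
      using keys_mult by fastforce
    then show False
      using assms[of a' b'] unfolding s_def keys_diff_single by auto
  qed
  moreover have "Poly_Mapping.lookup (s * t) (a + b) = Poly_Mapping.lookup f a * Poly_Mapping.lookup g b"
    by (simp add: s_def t_def mult_single)
  ultimately show ?thesis
    by (simp add: lookup_add in_keys_iff)
qed

lemma add_mem_keys_monomial_mult:
  fixes f :: "'a :: cancel_comm_monoid_add \<Rightarrow>\<^sub>0 'b :: comm_ring_1"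
  assumes "b \<in> Poly_Mapping.keys f"
  shows "a + b \<in> Poly_Mapping.keys (Poly_Mapping.single a 1 * f)"
  using lookup_mult_unique[of "Poly_Mapping.single a 1" f a b] assms
  by (auto simp: in_keys_iff split: if_splits)

text \<open>The type \<open>'n\<close> carries no order, but exponents indexed by \<open>nat\<close>
  have a linear order compatible with addition. Relabelling the variables injectively by natural
  numbers pulls this order back along \<open>h\<close>.\<close>

lemma ex_monomial_order:
  "\<exists>h :: ('n :: finite \<Rightarrow>\<^sub>0 nat) \<Rightarrow> (nat \<Rightarrow>\<^sub>0 nat). inj h \<and> (\<forall>a b. h (a + b) = h a + h b)"
proof -
  obtain e :: "'n \<Rightarrow> nat" where e: "inj e"
    using finite_imp_inj_to_nat_seg[OF finite_class.finite_UNIV] by blast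
  define h where "h a = (\<Sum>i\<in>UNIV. Poly_Mapping.single (e i) (Poly_Mapping.lookup a i))"
    for a :: "'n \<Rightarrow>\<^sub>0 nat"
  have "Poly_Mapping.lookup (h a) (e j) = Poly_Mapping.lookup a j" for a j
    by (simp add: h_def lookup_sum lookup_single when_def inj_eq[OF e])
  then have "inj h"
    by (metis injI poly_mapping_eqI)
  moreover have "h (a + b) = h a + h b" for a b
    by (simp add: h_def lookup_add single_add sum.distrib)
  ultimately show ?thesis by blast
qed

text \<open>The factors' leading terms with respect to a monomial order cannot cancel in the product.\<close>

lemma ex_leading_keys:
  fixes f g :: "('n :: finite, 'k :: field) mpoly"
  assumes "f \<noteq> 0" "g \<noteq> 0"
  obtains a b where "a \<in> Poly_Mapping.keys f" "b \<in> Poly_Mapping.keys g"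
    "a + b \<in> Poly_Mapping.keys (f * g)"
proof -
  obtain h :: "('n \<Rightarrow>\<^sub>0 nat) \<Rightarrow> (nat \<Rightarrow>\<^sub>0 nat)"
    where h: "inj h" "\<And>a b. h (a + b) = h a + h b"
    using ex_monomial_order by blast
  have ex: "\<exists>a\<in>Poly_Mapping.keys p. \<forall>a'\<in>Poly_Mapping.keys p. h a' \<le> h a" if "p \<noteq> 0" for p :: "('n, 'k) mpoly"
  proof -
    have "Max (h ` Poly_Mapping.keys p) \<in> h ` Poly_Mapping.keys p"
      using that by (intro Max_in) auto
    then obtain a where "a \<in> Poly_Mapping.keys p" "h a = Max (h ` Poly_Mapping.keys p)"
      by (metis imageE)
    then show ?thesis
      by (metis Max_ge finite_imageI finite_keys image_eqI)
  qed
  obtain a where a: "a \<in> Poly_Mapping.keys f" "\<And>a'. a' \<in> Poly_Mapping.keys f \<Longrightarrow> h a' \<le> h a"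
    using ex[OF assms(1)] by blast
  obtain b where b: "b \<in> Poly_Mapping.keys g" "\<And>b'. b' \<in> Poly_Mapping.keys g \<Longrightarrow> h b' \<le> h b"
    using ex[OF assms(2)] by blast
  have "a' = a \<and> b' = b"
    if "a' \<in> Poly_Mapping.keys f" "b' \<in> Poly_Mapping.keys g" "a' + b' = a + b" for a' b'
  proof -
    have "h a' + h b' = h a + h b"
      using that h(2) by metis
    \<comment> \<open>If either maximality inequality were strict, the sum would be strictly smaller
      too.\<close>
    then have "h a' = h a" "h b' = h b"
      using a(2)[OF that(1)] b(2)[OF that(2)]
      by (metis add_less_le_mono add_le_less_mono order.not_eq_order_implies_strict less_irrefl)+
    then show ?thesis
      using h(1) by (auto dest: injD)
  qed
  then have "Poly_Mapping.lookup (f * g) (a + b) = Poly_Mapping.lookup f a * Poly_Mapping.lookup g b"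
    by (rule lookup_mult_unique)
  then have "a + b \<in> Poly_Mapping.keys (f * g)"
    using a(1) b(1) by (simp add: in_keys_iff)
  with a(1) b(1) that show thesis by blast
qed


section \<open>Monomial ideals as sets of exponents\<close>

text \<open>For exponent vectors, adding \<open>b\<close> means multiplying by a monomial, so this
  is closure under multiples in the divisibility order.\<close>

definition up_closed :: "'a :: plus set \<Rightarrow> bool"
  where "up_closed U \<longleftrightarrow> (\<forall>a\<in>U. \<forall>b. a + b \<in> U)"

lemma up_closedD: "up_closed U \<Longrightarrow> a \<in> U \<Longrightarrow> a + b \<in> U"
  by (simp add: up_closed_def)

text \<open>Phrasing membership through supports turns questions about monomial ideals into
  questions about exponents.\<close>

definition monomial_span :: "('n \<Rightarrow>\<^sub>0 nat) set \<Rightarrow> ('n, 'k :: comm_ring_1) mpoly set"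
  where "monomial_span U = {f. Poly_Mapping.keys f \<subseteq> U}"

section \<open>Ideals of polynomials supported in an upward closed set\<close>

lemma mpoly_ring_simps [simp]:
  "carrier (mpoly_ring :: ('n, 'k :: comm_ring_1) mpoly ring) = UNIV"
  "f \<otimes>\<^bsub>mpoly_ring\<^esub> g = f * g"
  "f \<oplus>\<^bsub>mpoly_ring\<^esub> g = f + g"
  "\<one>\<^bsub>mpoly_ring\<^esub> = (1 :: ('n, 'k) mpoly)"
  "\<zero>\<^bsub>mpoly_ring\<^esub> = (0 :: ('n, 'k) mpoly)"
  for f g :: "('n, 'k :: comm_ring_1) mpoly"
  by (simp_all add: ring_of_type_algebra_def)

lemma cring_mpoly_ring: "cring (mpoly_ring :: ('n, 'k :: comm_ring_1) mpoly ring)"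
  by (rule cring_from_type_algebra)

lemma single_mem_monomial_span_iff:
  "Poly_Mapping.single a 1 \<in> (monomial_span U :: ('n, 'k :: comm_ring_1) mpoly set) \<longleftrightarrow> a \<in> U"
  by (simp add: monomial_span_def)

lemma monomial_span_add: "f \<in> monomial_span U \<Longrightarrow> g \<in> monomial_span U \<Longrightarrow> f + g \<in> monomial_span U"
  using keys_add[of f g] by (auto simp: monomial_span_def)

lemma monomial_span_diff: "f \<in> monomial_span U \<Longrightarrow> g \<in> monomial_span U \<Longrightarrow> f - g \<in> monomial_span U"
  using keys_diff[of f g] by (auto simp: monomial_span_def)

lemma monomial_span_mult:
  assumes "up_closed U" "f \<in> monomial_span U"
  shows "g * f \<in> monomial_span U"
  unfolding monomial_span_def
proof (clarify)
  fix c assume "c \<in> Poly_Mapping.keys (g * f)"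
  then obtain a b where "c = a + b" "b \<in> Poly_Mapping.keys f"
    using keys_mult by fastforce
  with assms show "c \<in> U"
    by (auto simp: monomial_span_def add.commute[of a] intro: up_closedD)
qed

lemma ideal_monomial_span:
  assumes "up_closed U"
  shows "ideal (monomial_span U :: ('n, 'k :: comm_ring_1) mpoly set) mpoly_ring"
proof -
  interpret R: cring "mpoly_ring :: ('n, 'k) mpoly ring" by (rule cring_mpoly_ring)
  have inv: "\<ominus>\<^bsub>mpoly_ring\<^esub> f = - f" for f :: "('n, 'k) mpoly"
    by (rule R.minus_equality) simp_all
  show ?thesis
  proof (rule idealI)
    show "subgroup (monomial_span U :: ('n, 'k) mpoly set) (add_monoid mpoly_ring)"
    proof (rule R.add.subgroupI)
      have "(0 :: ('n, 'k) mpoly) \<in> monomial_span U"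
        by (simp add: monomial_span_def)
      then show "(monomial_span U :: ('n, 'k) mpoly set) \<noteq> {}" by blast
    next
      fix f :: "('n, 'k) mpoly" assume "f \<in> monomial_span U"
      then show "\<ominus>\<^bsub>mpoly_ring\<^esub> f \<in> monomial_span U"
        unfolding inv by (simp add: monomial_span_def keys_def)
    qed (simp_all add: monomial_span_add)
  next
    fix f g :: "('n, 'k) mpoly" assume "f \<in> monomial_span U"
    then show "g \<otimes>\<^bsub>mpoly_ring\<^esub> f \<in> monomial_span U" "f \<otimes>\<^bsub>mpoly_ring\<^esub> g \<in> monomial_span U"
      using monomial_span_mult[OF assms, of f g] by (simp_all add: mult.commute)
  qed (rule R.ring_axioms)
qed

lemma sum_singles:
  "(\<Sum>a\<in>Poly_Mapping.keys f. Poly_Mapping.single a (Poly_Mapping.lookup f a)) = f"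
  by (rule poly_mapping_eqI) (simp add: lookup_sum lookup_single when_def in_keys_iff)

lemma monomial_span_minimal:
  fixes K :: "('n, 'k :: comm_ring_1) mpoly set"
  assumes K: "ideal K mpoly_ring" and U: "\<And>a. a \<in> U \<Longrightarrow> Poly_Mapping.single a 1 \<in> K"
  shows "monomial_span U \<subseteq> K"
proof
  interpret K: ideal K mpoly_ring by fact
  fix f :: "('n, 'k) mpoly" assume f: "f \<in> monomial_span U"
  have "(\<Sum>a\<in>T. Poly_Mapping.single a (Poly_Mapping.lookup f a)) \<in> K"
    if "finite T" "T \<subseteq> U" for T
    using that
  proof (induction T)
    case empty
    show ?case
      using additive_subgroup.zero_closed[OF K.additive_subgroup_axioms] by simp
  next
    case (insert a T)
    have "Poly_Mapping.single 0 (Poly_Mapping.lookup f a) * Poly_Mapping.single a 1 \<in> K"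
      using K.I_l_closed U insert.prems by auto
    then have "Poly_Mapping.single a (Poly_Mapping.lookup f a) \<in> K"
      by (simp add: mult_single)
    then show ?case
      using additive_subgroup.a_closed[OF K.additive_subgroup_axioms] insert by simp
  qed
  from this[of "Poly_Mapping.keys f"] f show "f \<in> K"
    by (simp add: sum_singles monomial_span_def)
qed

text \<open>The last assumption says that every monomial with exponent in \<open>U\<close> is a
  multiple of a monomial in \<open>G\<close>. Other elements of \<open>G\<close> may have several
  terms, as happens for the generators of a square power.\<close>

lemma genideal_eq_monomial_span:
  fixes G :: "('n, 'k :: comm_ring_1) mpoly set"
  assumes "up_closed U" "G \<subseteq> monomial_span U"
    and "\<And>a. a \<in> U \<Longrightarrow> \<exists>b c. a = b + c \<and> Poly_Mapping.single b 1 \<in> G"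
  shows "Idl\<^bsub>mpoly_ring\<^esub> G = monomial_span U"
proof -
  interpret R: cring "mpoly_ring :: ('n, 'k) mpoly ring" by (rule cring_mpoly_ring)
  interpret K: ideal "Idl\<^bsub>mpoly_ring\<^esub> G" mpoly_ring
    by (rule R.genideal_ideal) simp
  show ?thesis
  proof
    show "Idl\<^bsub>mpoly_ring\<^esub> G \<subseteq> monomial_span U"
      using assms by (intro R.genideal_minimal ideal_monomial_span)
    show "monomial_span U \<subseteq> Idl\<^bsub>mpoly_ring\<^esub> G"
    proof (rule monomial_span_minimal)
      show "ideal (Idl\<^bsub>mpoly_ring\<^esub> G) mpoly_ring" by (rule K.is_ideal)
      fix a assume "a \<in> U"
      then obtain b c where abc: "a = b + c" "Poly_Mapping.single b 1 \<in> G"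
        using assms(3) by blast
      then have "Poly_Mapping.single b 1 \<in> Idl\<^bsub>mpoly_ring\<^esub> G"
        using R.genideal_self[of G] by auto
      then have "Poly_Mapping.single c 1 * Poly_Mapping.single b 1 \<in> Idl\<^bsub>mpoly_ring\<^esub> G"
        using K.I_l_closed by auto
      then show "Poly_Mapping.single a 1 \<in> Idl\<^bsub>mpoly_ring\<^esub> G"
        by (simp add: mult_single abc add.commute)
    qed
  qed
qed

section \<open>Monomial ideals, their products and powers\<close>

lemma monomial_ideal_eq_monomial_span:
  assumes "monomial_ideal I"
  obtains U where "up_closed U" "I = monomial_span U"
proof -
  obtain A where A: "I = Idl\<^bsub>mpoly_ring\<^esub> (mpoly_monomial ` A)"
    using assms by (auto simp: monomial_ideal_def)
  define U where "U = {a + b | a b. a \<in> A}"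
  have "up_closed U"
    unfolding up_closed_def U_def by clarify (metis add.assoc)
  moreover have "mpoly_monomial ` A \<subseteq> monomial_span U"
    unfolding U_def
    by (auto simp: mpoly_monomial_eq_single single_mem_monomial_span_iff) (metis add.right_neutral)
  moreover have "\<exists>b c. a = b + c \<and> Poly_Mapping.single b 1 \<in> mpoly_monomial ` A" if "a \<in> U" for a
    using that by (auto simp: U_def mpoly_monomial_eq_single)
  ultimately have "I = monomial_span U"
    unfolding A by (rule genideal_eq_monomial_span)
  with \<open>up_closed U\<close> that show thesis by blast
qed

text \<open>The iterated sumset mirrors the recursion for powers of ideals. It starts at
  \<open>UNIV\<close> because the zeroth power is the whole ring.\<close>

primrec exponent_power :: "('n \<Rightarrow>\<^sub>0 nat) set \<Rightarrow> nat \<Rightarrow> ('n \<Rightarrow>\<^sub>0 nat) set"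
  where
    "exponent_power U 0 = UNIV"
  | "exponent_power U (Suc s) = {a + b | a b. a \<in> exponent_power U s \<and> b \<in> U}"

lemma up_closed_sumset:
  fixes U V :: "'a :: semigroup_add set"
  assumes "up_closed V"
  shows "up_closed {a + b | a b. a \<in> U \<and> b \<in> V}"
  using assms unfolding up_closed_def by clarify (metis add.assoc)

lemma up_closed_exponent_power: "up_closed U \<Longrightarrow> up_closed (exponent_power U s)"
  by (cases s) (simp_all add: up_closed_sumset, simp add: up_closed_def)

lemma ideal_prod_monomial_span:
  assumes "up_closed U" "up_closed V"
  shows "monomial_span U \<cdot>\<^bsub>mpoly_ring\<^esub> monomial_span V =
    (monomial_span {a + b | a b. a \<in> U \<and> b \<in> V} :: ('n, 'k :: comm_ring_1) mpoly set)" (is "?L = ?R")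
proof
  interpret R: cring "mpoly_ring :: ('n, 'k) mpoly ring" by (rule cring_mpoly_ring)
  show "?L \<subseteq> ?R"
  proof
    fix f assume "f \<in> ?L"
    then show "f \<in> ?R"
    proof induction
      case (prod i j)
      then have "Poly_Mapping.keys i \<subseteq> U" "Poly_Mapping.keys j \<subseteq> V"
        by (auto simp: monomial_span_def)
      with keys_mult[of i j] show ?case
        unfolding monomial_span_def by fastforce
    qed (simp add: monomial_span_add)
  qed
  show "?R \<subseteq> ?L"
  proof (rule monomial_span_minimal)
    show "ideal ?L mpoly_ring"
      using assms by (intro R.ideal_prod_is_ideal ideal_monomial_span)
    fix c assume "c \<in> {a + b | a b. a \<in> U \<and> b \<in> V}"
    then obtain a b where c: "c = a + b" and "a \<in> U" "b \<in> V" by blast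
    then have "Poly_Mapping.single a 1 \<otimes>\<^bsub>mpoly_ring\<^esub> Poly_Mapping.single b 1 \<in> ?L"
      by (intro ideal_prod.prod) (simp_all add: single_mem_monomial_span_iff)
    then show "Poly_Mapping.single c 1 \<in> ?L"
      by (simp add: c mult_single)
  qed
qed

lemma monomial_span_power:
  assumes "up_closed U"
  shows "(monomial_span U :: ('n, 'k :: comm_ring_1) mpoly set) [^]\<^bsub>ideals_set mpoly_ring\<^esub> s =
    monomial_span (exponent_power U s)"
proof (induction s)
  case 0
  then show ?case
    by (simp add: nat_pow_def ideals_set_def monomial_span_def)
next
  case (Suc s)
  then show ?case
    using ideal_prod_monomial_span[OF up_closed_exponent_power[OF assms] assms]
    by (simp add: nat_pow_def ideals_set_def)
qed


section \<open>Associated primes of monomial ideals\<close>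

text \<open>Every element of the quotient is a coset of some \<open>f\<close>, and \<open>r\<close>
  kills it exactly when \<open>r * f\<close> lies in \<open>J\<close>. Associated primes are thus
  the prime colon ideals \<open>(J : f)\<close>.\<close>

lemma associated_primes_quotient_module:
  fixes J :: "('n, 'k :: comm_ring_1) mpoly set"
  assumes "ideal J mpoly_ring"
  shows "associated_primes mpoly_ring (quotient_module mpoly_ring J) =
    {P. primeideal P mpoly_ring \<and> (\<exists>f. P = {r. r * f \<in> J})}"
proof -
  interpret R: cring "mpoly_ring :: ('n, 'k) mpoly ring" by (rule cring_mpoly_ring)
  interpret J: ideal J mpoly_ring by fact
  have "annihilator mpoly_ring (quotient_module mpoly_ring J) (J +>\<^bsub>mpoly_ring\<^esub> f) = {r. r * f \<in> J}" for f
  proof -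
    have "J +>\<^bsub>mpoly_ring\<^esub> g = J \<longleftrightarrow> g \<in> J" for g
      using J.rcos_const_imp_mem[of g] R.a_rcos_zero[OF assms, of g] by auto
    then show ?thesis
      by (simp add: annihilator_def quotient_module_def FactRing_def J.rcoset_mult_add)
  qed
  moreover have "carrier (quotient_module mpoly_ring J) = range (\<lambda>f. J +>\<^bsub>mpoly_ring\<^esub> f)"
    by (auto simp: quotient_module_def FactRing_def A_RCOSETS_def')
  ultimately show ?thesis
    by (auto simp: associated_primes_def)
qed

text \<open>
  Choose \<open>f\<close> with \<open>P = (J : f)\<close> and as few terms as possible. If \<open>X^b\<close> moves some term of
  \<open>f\<close> into \<open>J\<close> but \<open>X^b \<notin> P\<close>, then \<open>X^b f\<close> without that term would be a shorter choice.
  So \<open>P\<close> contains every leading monomial of its elements, and it agrees with \<open>(J : X^u)\<close>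
  for each term \<open>X^u\<close> of \<open>f\<close>.
\<close>

lemma prime_colon_eq_monomial_colon:
  fixes P :: "('n :: finite, 'k :: field) mpoly set"
  assumes U: "up_closed U" and prime: "primeideal P mpoly_ring"
    and colon: "P = {r. r * f \<in> monomial_span U}"
  shows "\<exists>u. P = monomial_span {b. u + b \<in> U}"
proof -
  interpret P: primeideal P mpoly_ring by fact
  obtain f where f: "P = {r. r * f \<in> monomial_span U}"
    and min: "\<And>f'. card (Poly_Mapping.keys f') < card (Poly_Mapping.keys f) \<Longrightarrow> P \<noteq> {r. r * f' \<in> monomial_span U}"
    using exists_least_iff[of "\<lambda>k. \<exists>f. P = {r. r * f \<in> monomial_span U} \<and> card (Poly_Mapping.keys f) = k"] colon
    by blast
  have mono: "Poly_Mapping.single b 1 \<in> P" if u: "u \<in> Poly_Mapping.keys f" and bu: "u + b \<in> U" for u b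
  proof (rule ccontr)
    assume b: "Poly_Mapping.single b 1 \<notin> P"
    define t where "t = Poly_Mapping.single u (Poly_Mapping.lookup f u)"
    define f' where "f' = Poly_Mapping.single b 1 * (f - t)"
    have "Poly_Mapping.keys f' \<subseteq> (+) b ` (Poly_Mapping.keys f - {u})"
      using keys_mult[of "Poly_Mapping.single b (1 :: 'k)" "f - t"]
      unfolding f'_def t_def keys_diff_single by auto
    then have "card (Poly_Mapping.keys f') \<le> card (Poly_Mapping.keys f - {u})"
      by (meson card_image_le card_mono finite_Diff finite_imageI finite_keys order_trans)
    also have "\<dots> < card (Poly_Mapping.keys f)"
      using u by (intro card_Diff1_less) simp_all
    finally have "P \<noteq> {r. r * f' \<in> monomial_span U}" by (rule min)
    \<comment> \<open>Multiplied by \<open>X^b\<close>, the removed term lies in the ideal, so the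
      colon by \<open>f'\<close> equals \<open>(P : X^b)\<close>. This is \<open>P\<close> itself,
      since \<open>P\<close> is prime and does not contain \<open>X^b\<close>.\<close>
    moreover have "r * f' \<in> monomial_span U \<longleftrightarrow> r \<in> P" for r
    proof -
      have "Poly_Mapping.single b 1 * t \<in> monomial_span U"
        using bu by (simp add: t_def mult_single monomial_span_def add.commute)
      then have rt: "r * (Poly_Mapping.single b 1 * t) \<in> monomial_span U"
        by (rule monomial_span_mult[OF U])
      have eq: "r * Poly_Mapping.single b 1 * f = r * f' + r * (Poly_Mapping.single b 1 * t)"
        by (simp add: f'_def algebra_simps)
      have "r * f' \<in> monomial_span U \<longleftrightarrow> r * Poly_Mapping.single b 1 * f \<in> monomial_span U"
        using monomial_span_add[OF _ rt, of "r * f'"] monomial_span_diff[OF _ rt, of "r * Poly_Mapping.single b 1 * f"]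
        unfolding eq by auto
      also have "\<dots> \<longleftrightarrow> r * Poly_Mapping.single b 1 \<in> P"
        using f by blast
      also have "\<dots> \<longleftrightarrow> r \<in> P"
        using P.I_prime[of r "Poly_Mapping.single b 1"] P.I_r_closed[of r "Poly_Mapping.single b 1"] b
        by auto
      finally show ?thesis .
    qed
    ultimately show False by blast
  qed
  have "f \<noteq> 0"
    using f P.I_notcarr by (auto simp: monomial_span_def)
  then obtain u where u: "u \<in> Poly_Mapping.keys f"
    by (metis all_not_in_conv keys_eq_empty)
  have "P = monomial_span {b. u + b \<in> U}"
  proof
    show "monomial_span {b. u + b \<in> U} \<subseteq> P"
      using mono[OF u] by (intro monomial_span_minimal P.is_ideal) simp
    \<comment> \<open>Strip terms from \<open>g\<close> one at a time: a leading term of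
      \<open>g\<close> lies in \<open>P\<close> by \<open>mono\<close>, so subtracting it leaves an
      element of \<open>P\<close> with fewer terms.\<close>
    have up: "Poly_Mapping.keys g \<subseteq> {b. Poly_Mapping.single b 1 \<in> P}" if "g \<in> P" for g
      using that
    proof (induction "card (Poly_Mapping.keys g)" arbitrary: g rule: less_induct)
      case less
      show ?case
      proof (cases "g = 0")
        case False
        with \<open>f \<noteq> 0\<close> obtain a b where ab: "a \<in> Poly_Mapping.keys g" "b \<in> Poly_Mapping.keys f"
          "a + b \<in> Poly_Mapping.keys (g * f)"
          using ex_leading_keys by blast
        moreover have "g * f \<in> monomial_span U"
          using f less.prems by blast
        ultimately have "b + a \<in> U"
          by (auto simp: monomial_span_def add.commute)
        then have a: "Poly_Mapping.single a 1 \<in> P"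
          using mono ab by blast
        define t where "t = Poly_Mapping.single a (Poly_Mapping.lookup g a)"
        have "Poly_Mapping.single 0 (Poly_Mapping.lookup g a) * Poly_Mapping.single a 1 \<in> P"
          using P.I_l_closed[OF a] by simp
        then have "t \<in> P"
          by (simp add: t_def mult_single)
        then have "g - t \<in> P"
          using less.prems monomial_span_diff[of "g * f" U "t * f"] f by (auto simp: algebra_simps)
        moreover have "Poly_Mapping.keys (g - t) = Poly_Mapping.keys g - {a}"
          unfolding t_def by (rule keys_diff_single)
        moreover have "card (Poly_Mapping.keys g - {a}) < card (Poly_Mapping.keys g)"
          using ab(1) by (intro card_Diff1_less) simp_all
        ultimately have "Poly_Mapping.keys g - {a} \<subseteq> {b. Poly_Mapping.single b 1 \<in> P}"
          using less.hyps[of "g - t"] by simp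
        with a show ?thesis by blast
      qed simp
    qed
    have "u + b \<in> U" if "Poly_Mapping.single b 1 \<in> P" for b
    proof -
      have "Poly_Mapping.single b 1 * f \<in> monomial_span U"
        using that f by blast
      then show ?thesis
        using add_mem_keys_monomial_mult[OF u, of b] by (auto simp: monomial_span_def add.commute)
    qed
    with up show "P \<subseteq> monomial_span {b. u + b \<in> U}"
      by (force simp: monomial_span_def)
  qed
  then show ?thesis by blast
qed

text \<open>A prime monomial ideal is generated by variables: a monomial in it is a product of
  powers of variables, so primality puts one of the variables that divide it into the ideal.\<close>

lemma prime_monomial_span_exponents:
  fixes V :: "('n :: finite \<Rightarrow>\<^sub>0 nat) set"
  assumes V: "up_closed V"
    and prime: "primeideal (monomial_span V :: ('n, 'k :: comm_ring_1) mpoly set) mpoly_ring"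
  shows "b \<in> V \<longleftrightarrow> (\<exists>i. Poly_Mapping.single i 1 \<in> V \<and> 0 < Poly_Mapping.lookup b i)"
proof
  interpret P: primeideal "monomial_span V :: ('n, 'k) mpoly set" mpoly_ring by fact
  have zero: "0 \<notin> V"
  proof
    assume "0 \<in> V"
    then have "V = UNIV"
      using V by (auto simp: up_closed_def)
    then show False
      using P.I_notcarr by (simp add: monomial_span_def)
  qed
  have add: "a \<in> V \<or> c \<in> V" if "a + c \<in> V" for a c
    using that P.I_prime[of "Poly_Mapping.single a 1" "Poly_Mapping.single c 1"]
    by (simp add: mult_single single_mem_monomial_span_iff)
  have pow: "Poly_Mapping.single i k \<in> V \<Longrightarrow> Poly_Mapping.single i 1 \<in> V \<and> 0 < k" for i k
  proof (induction k)
    case 0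
    then show ?case using zero by simp
  next
    case (Suc k)
    then show ?case
      using add[of "Poly_Mapping.single i 1" "Poly_Mapping.single i k"] by (auto simp flip: single_add)
  qed
  have sum: "\<exists>i. Poly_Mapping.single i 1 \<in> V \<and> 0 < Poly_Mapping.lookup b i"
    if "finite T" "(\<Sum>i\<in>T. Poly_Mapping.single i (Poly_Mapping.lookup b i)) \<in> V" for T
    using that
  proof (induction T)
    case (insert i T)
    then show ?case
      using add[of "Poly_Mapping.single i (Poly_Mapping.lookup b i)"] pow by auto
  qed (use zero in simp)
  show "\<exists>i. Poly_Mapping.single i 1 \<in> V \<and> 0 < Poly_Mapping.lookup b i" if "b \<in> V"
    using sum[of "Poly_Mapping.keys b"] that by (simp add: sum_singles)
  assume "\<exists>i. Poly_Mapping.single i 1 \<in> V \<and> 0 < Poly_Mapping.lookup b i"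
  then obtain i where i: "Poly_Mapping.single i 1 \<in> V" "0 < Poly_Mapping.lookup b i" by blast
  \<comment> \<open>Subtraction on \<open>nat\<close> is truncated; positivity of \<open>b\<close>
    at \<open>i\<close> makes it exact here.\<close>
  have "b = Poly_Mapping.single i 1 + (b - Poly_Mapping.single i 1)"
    using i(2) by (intro poly_mapping_eqI) (auto simp: lookup_add lookup_minus lookup_single when_def)
  with up_closedD[OF V i(1)] show "b \<in> V" by metis
qed

lemma up_closed_colon: "up_closed U \<Longrightarrow> up_closed {b. u + b \<in> U}"
  for U :: "'a :: semigroup_add set"
  by (auto simp: up_closed_def add.assoc[symmetric])

lemma monomial_colon_eq:
  assumes "up_closed U"
  shows "{r. r * Poly_Mapping.single u 1 \<in> monomial_span U} =
    (monomial_span {b. u + b \<in> U} :: ('n, 'k :: comm_ring_1) mpoly set)"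
proof (intro equalityI subsetI)
  fix r :: "('n, 'k) mpoly"
  assume "r \<in> {r. r * Poly_Mapping.single u 1 \<in> monomial_span U}"
  then show "r \<in> monomial_span {b. u + b \<in> U}"
    using add_mem_keys_monomial_mult[of _ r u] by (auto simp: monomial_span_def mult.commute)
next
  fix r :: "('n, 'k) mpoly"
  assume "r \<in> monomial_span {b. u + b \<in> U}"
  then show "r \<in> {r. r * Poly_Mapping.single u 1 \<in> monomial_span U}"
    using keys_mult[of r "Poly_Mapping.single u (1 :: 'k)"]
    by (fastforce simp: monomial_span_def add.commute)
qed

text \<open>This form isolates the dependence on \<open>U\<close> in the clause with
  \<open>u\<close>; primality and the shape of \<open>P\<close> involve only \<open>P\<close> and
  \<open>S\<close>. Two monomial ideals for which the same sets \<open>S\<close> admit some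
  \<open>u\<close> therefore have the same associated primes.\<close>

lemma associated_primes_monomial_span:
  assumes U: "up_closed U"
  shows "associated_primes mpoly_ring (quotient_module mpoly_ring (monomial_span U)) =
    {P :: ('n :: finite, 'k :: field) mpoly set. primeideal P mpoly_ring \<and>
      (\<exists>S. P = monomial_span {b. \<exists>i\<in>S. 0 < Poly_Mapping.lookup b i} \<and>
        (\<exists>u. \<forall>b. u + b \<in> U \<longleftrightarrow> (\<exists>i\<in>S. 0 < Poly_Mapping.lookup b i)))}" (is "_ = ?A")
  unfolding associated_primes_quotient_module[OF ideal_monomial_span[OF U]]
proof (intro equalityI subsetI)
  fix P :: "('n, 'k) mpoly set"
  assume "P \<in> {P. primeideal P mpoly_ring \<and> (\<exists>f. P = {r. r * f \<in> monomial_span U})}"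
  then obtain u where P: "primeideal P mpoly_ring" "P = monomial_span {b. u + b \<in> U}"
    using prime_colon_eq_monomial_colon[OF U] by blast
  \<comment> \<open>The set \<open>S\<close> consists of the variables that lie in
    \<open>P\<close>.\<close>
  have "u + b \<in> U \<longleftrightarrow> (\<exists>i\<in>{i. u + Poly_Mapping.single i 1 \<in> U}. 0 < Poly_Mapping.lookup b i)" for b
    using prime_monomial_span_exponents[OF up_closed_colon[OF U] P(1)[unfolded P(2)], of b] by simp
  then obtain S where S: "\<forall>b. u + b \<in> U \<longleftrightarrow> (\<exists>i\<in>S. 0 < Poly_Mapping.lookup b i)"
    by blast
  then have "P = monomial_span {b. \<exists>i\<in>S. 0 < Poly_Mapping.lookup b i}"
    using P(2) by simp
  with P(1) S show "P \<in> ?A" by blast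
next
  fix P assume "P \<in> ?A"
  then obtain S u where P: "primeideal P mpoly_ring" "P = monomial_span {b. \<exists>i\<in>S. 0 < Poly_Mapping.lookup b i}"
    and S: "\<forall>b. u + b \<in> U \<longleftrightarrow> (\<exists>i\<in>S. 0 < Poly_Mapping.lookup b i)"
    by blast
  have "P = monomial_span {b. u + b \<in> U}"
    using P(2) S by simp
  with P(1) show "P \<in> {P. primeideal P mpoly_ring \<and> (\<exists>f. P = {r. r * f \<in> monomial_span U})}"
    using monomial_colon_eq[OF U, of u] by blast
qed


section \<open>Square powers\<close>

text \<open>Since \<open>'n\<close> is finite, every function has finite support, so exponents can
  be defined pointwise.\<close>

definition exponent_of :: "('n :: finite \<Rightarrow> nat) \<Rightarrow> ('n \<Rightarrow>\<^sub>0 nat)"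
  where "exponent_of f = Abs_poly_mapping f"

lemma lookup_exponent_of [simp]: "Poly_Mapping.lookup (exponent_of f) = f"
  by (simp add: exponent_of_def)

definition exponent_scale :: "nat \<Rightarrow> ('n :: finite \<Rightarrow>\<^sub>0 nat) \<Rightarrow> ('n \<Rightarrow>\<^sub>0 nat)"
  where "exponent_scale m a = exponent_of (\<lambda>i. m * Poly_Mapping.lookup a i)"

definition exponent_div :: "nat \<Rightarrow> ('n :: finite \<Rightarrow>\<^sub>0 nat) \<Rightarrow> ('n \<Rightarrow>\<^sub>0 nat)"
  where "exponent_div m a = exponent_of (\<lambda>i. Poly_Mapping.lookup a i div m)"

definition exponent_mod :: "nat \<Rightarrow> ('n :: finite \<Rightarrow>\<^sub>0 nat) \<Rightarrow> ('n \<Rightarrow>\<^sub>0 nat)"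
  where "exponent_mod m a = exponent_of (\<lambda>i. Poly_Mapping.lookup a i mod m)"

section \<open>Componentwise multiplication and division of exponents by \<open>m\<close>\<close>

lemma exponent_scale_add: "exponent_scale m (a + b) = exponent_scale m a + exponent_scale m b"
  by (rule poly_mapping_eqI) (simp add: exponent_scale_def lookup_add algebra_simps)

lemma exponent_scale_div_mod: "exponent_scale m (exponent_div m a) + exponent_mod m a = a"
  by (rule poly_mapping_eqI)
    (simp add: exponent_scale_def exponent_div_def exponent_mod_def lookup_add)

lemma exponent_div_scale_add:
  "0 < m \<Longrightarrow> exponent_div m (exponent_scale m a + b) = a + exponent_div m b"
  by (rule poly_mapping_eqI) (simp add: exponent_scale_def exponent_div_def lookup_add)

lemma exponent_div_scale: "0 < m \<Longrightarrow> exponent_div m (exponent_scale m a) = a"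
  by (rule poly_mapping_eqI) (simp add: exponent_scale_def exponent_div_def)

text \<open>The extra summand \<open>c\<close> is the carry from adding the two remainders. Upward
  closed sets absorb it.\<close>

lemma exponent_div_add:
  "\<exists>c. exponent_div m (a + b) = exponent_div m a + exponent_div m b + c"
proof
  show "exponent_div m (a + b) = exponent_div m a + exponent_div m b +
      exponent_div m (exponent_mod m a + exponent_mod m b)"
    by (rule poly_mapping_eqI)
      (simp only: exponent_div_def exponent_mod_def lookup_exponent_of lookup_add, rule div_add1_eq)
qed

lemma up_closed_vimage_exponent_div:
  assumes "up_closed U"
  shows "up_closed (exponent_div m -` U)"
  unfolding up_closed_def
proof clarify
  fix a b assume "exponent_div m a \<in> U"
  moreover obtain c where "exponent_div m (a + b) = exponent_div m a + (exponent_div m b + c)"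
    using exponent_div_add[of m a b] by (auto simp: add.assoc)
  ultimately show "a + b \<in> exponent_div m -` U"
    using up_closedD[OF assms] by simp
qed

lemma exponent_power_vimage_div:
  assumes m: "0 < m" and U: "up_closed U"
  shows "exponent_power (exponent_div m -` U) s = exponent_div m -` exponent_power U s"
proof (induction s)
  case (Suc s)
  let ?V = "exponent_power U s"
  have "(\<exists>a b. c = a + b \<and> exponent_div m a \<in> ?V \<and> exponent_div m b \<in> U) \<longleftrightarrow>
      (\<exists>a b. exponent_div m c = a + b \<and> a \<in> ?V \<and> b \<in> U)" (is "?L \<longleftrightarrow> ?R") for c
  proof
    assume ?L
    then obtain a b where ab: "c = a + b" "exponent_div m a \<in> ?V" "exponent_div m b \<in> U"
      by blast
    moreover obtain d where "exponent_div m (a + b) = exponent_div m a + (exponent_div m b + d)"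
      using exponent_div_add[of m a b] by (auto simp: add.assoc)
    ultimately show ?R
      using up_closedD[OF U] by blast
  next
    assume ?R
    then obtain a b where ab: "exponent_div m c = a + b" "a \<in> ?V" "b \<in> U"
      by blast
    \<comment> \<open>The whole remainder of \<open>c\<close> goes into the second summand; division
      by \<open>m\<close> then recovers exactly \<open>a\<close> and \<open>b\<close>.\<close>
    have "c = exponent_scale m a + (exponent_scale m b + exponent_mod m c)"
      using exponent_scale_div_mod[of m c] unfolding ab exponent_scale_add by (simp add: add.assoc)
    moreover have "exponent_div m (exponent_scale m b + exponent_mod m c) \<in> U"
      unfolding exponent_div_scale_add[OF m] using ab U by (simp add: up_closedD)
    moreover have "exponent_div m (exponent_scale m a) \<in> ?V"
      using ab by (simp add: exponent_div_scale[OF m])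
    ultimately show ?L by blast
  qed
  with Suc show ?case by auto
qed simp

section \<open>Square powers of monomial ideals and their associated primes\<close>

lemma square_power_poly_eq:
  fixes f :: "('n :: finite, 'k :: comm_ring_1) mpoly"
  shows "square_power_poly m f =
    (\<Sum>a\<in>Poly_Mapping.keys f. Poly_Mapping.single (exponent_scale m a) (Poly_Mapping.lookup f a))"
proof -
  have "(\<Prod>i\<in>UNIV. ((mpoly_var i :: ('n, 'k) mpoly) ^ m) ^ Poly_Mapping.lookup a i) =
      Poly_Mapping.single (exponent_scale m a) 1" for a
    using mpoly_monomial_eq_single[of "exponent_scale m a", where 'k = 'k]
    by (simp add: mpoly_monomial_def exponent_scale_def power_mult)
  then show ?thesis
    by (simp add: square_power_poly_def mpoly_subst_def mpoly_const_def mult_single)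
qed

lemma square_power_ideal_monomial_span:
  assumes m: "0 < m" and U: "up_closed U"
  shows "square_power_ideal m (monomial_span U :: ('n :: finite, 'k :: comm_ring_1) mpoly set) =
    monomial_span (exponent_div m -` U)"
  unfolding square_power_ideal_def
proof (rule genideal_eq_monomial_span)
  show "up_closed (exponent_div m -` U)"
    by (rule up_closed_vimage_exponent_div[OF U])
  show "square_power_poly m ` (monomial_span U :: ('n, 'k) mpoly set) \<subseteq> monomial_span (exponent_div m -` U)"
  proof (clarify)
    fix f :: "('n, 'k) mpoly" assume f: "f \<in> monomial_span U"
    have "Poly_Mapping.keys (square_power_poly m f) \<subseteq> exponent_scale m ` Poly_Mapping.keys f"
      unfolding square_power_poly_eq using keys_sum by (fastforce split: if_splits)
    with f show "square_power_poly m f \<in> monomial_span (exponent_div m -` U)"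
      by (fastforce simp: monomial_span_def exponent_div_scale[OF m])
  qed
  fix a assume "a \<in> exponent_div m -` U"
  \<comment> \<open>The required monomial divisor of \<open>X^a\<close> is the square power of the
    monomial with exponent \<open>exponent_div m a\<close>; the cofactor has exponent
    \<open>exponent_mod m a\<close>.\<close>
  then have "square_power_poly m (Poly_Mapping.single (exponent_div m a) 1) \<in>
      square_power_poly m ` (monomial_span U :: ('n, 'k) mpoly set)"
    by (intro imageI) (simp add: single_mem_monomial_span_iff)
  then have "Poly_Mapping.single (exponent_scale m (exponent_div m a)) 1 \<in>
      square_power_poly m ` (monomial_span U :: ('n, 'k) mpoly set)"
    by (simp add: square_power_poly_eq)
  then show "\<exists>b c. a = b + c \<and> Poly_Mapping.single b 1 \<in> square_power_poly m ` (monomial_span U :: ('n, 'k) mpoly set)"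
    by (metis exponent_scale_div_mod)
qed

text \<open>The set \<open>S\<close> is the same on both sides, and so is the prime it generates.
  Only the witness changes: rounding \<open>v\<close> down gives \<open>u\<close>, while scaling
  \<open>u\<close> and filling the remainders on \<open>S\<close> gives \<open>v\<close>.\<close>

lemma ex_colon_vimage_exponent_div_iff:
  assumes m: "0 < m"
  shows "(\<exists>v. \<forall>b. v + b \<in> exponent_div m -` U \<longleftrightarrow> (\<exists>i\<in>S. 0 < Poly_Mapping.lookup b i)) \<longleftrightarrow>
    (\<exists>u. \<forall>b. u + b \<in> U \<longleftrightarrow> (\<exists>i\<in>S. 0 < Poly_Mapping.lookup b i))"
proof (intro iffI; elim exE)
  fix v assume v: "\<forall>b. v + b \<in> exponent_div m -` U \<longleftrightarrow> (\<exists>i\<in>S. 0 < Poly_Mapping.lookup b i)"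
  \<comment> \<open>It suffices to test \<open>v\<close> on multiples of \<open>m\<close>: adding
    \<open>m\<close> times \<open>b\<close> to \<open>v\<close> raises the quotient by exactly
    \<open>b\<close>, and scaling by a positive \<open>m\<close> preserves which entries are
    positive.\<close>
  have "exponent_div m v + b \<in> U \<longleftrightarrow> (\<exists>i\<in>S. 0 < Poly_Mapping.lookup b i)" for b
    using v[rule_format, of "exponent_scale m b"] exponent_div_scale_add[OF m, of b v] m
    by (simp add: add.commute exponent_scale_def)
  then show "\<exists>u. \<forall>b. u + b \<in> U \<longleftrightarrow> (\<exists>i\<in>S. 0 < Poly_Mapping.lookup b i)" by blast
next
  fix u assume u: "\<forall>b. u + b \<in> U \<longleftrightarrow> (\<exists>i\<in>S. 0 < Poly_Mapping.lookup b i)"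
  \<comment> \<open>Adding \<open>m - 1\<close> makes every positive increment in a variable of \<open>S\<close> carry over.\<close>
  define e where "e = exponent_of (\<lambda>i. if i \<in> S then m - 1 else 0)"
  have "exponent_scale m u + e + b \<in> exponent_div m -` U \<longleftrightarrow> (\<exists>i\<in>S. 0 < Poly_Mapping.lookup b i)" for b
  proof -
    have "0 < Poly_Mapping.lookup (exponent_div m (e + b)) i \<longleftrightarrow> 0 < Poly_Mapping.lookup b i"
      if "i \<in> S" for i
      using that m by (auto simp: exponent_div_def e_def lookup_add div_greater_zero_iff)
    then show ?thesis
      using u by (simp add: add.assoc exponent_div_scale_add[OF m])
  qed
  then show "\<exists>v. \<forall>b. v + b \<in> exponent_div m -` U \<longleftrightarrow> (\<exists>i\<in>S. 0 < Poly_Mapping.lookup b i)" by blast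
qed

lemma associated_primes_vimage_exponent_div:
  assumes "0 < m" "up_closed U"
  shows "associated_primes mpoly_ring (quotient_module mpoly_ring
      (monomial_span (exponent_div m -` U) :: ('n :: finite, 'k :: field) mpoly set)) =
    associated_primes mpoly_ring (quotient_module mpoly_ring (monomial_span U))"
  using assms by (simp only: associated_primes_monomial_span up_closed_vimage_exponent_div
      ex_colon_vimage_exponent_div_iff)

theorem theorem3p5:
  fixes I :: "('n :: finite, 'k :: field) mpoly set" and m :: nat
  assumes "monomial_ideal I"
    and "m \<ge> 2"
  shows "index_of_stability mpoly_ring I =
         index_of_stability mpoly_ring (square_power_ideal m I)"
proof -
  have m: "0 < m" using assms(2) by simp
  obtain U where U: "up_closed U" and I: "I = monomial_span U"
    using monomial_ideal_eq_monomial_span[OF assms(1)] .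
  have "associated_primes mpoly_ring (quotient_module mpoly_ring
      (square_power_ideal m I [^]\<^bsub>ideals_set mpoly_ring\<^esub> s)) =
    associated_primes mpoly_ring (quotient_module mpoly_ring (I [^]\<^bsub>ideals_set mpoly_ring\<^esub> s))"
    for s :: nat
    by (simp only: I square_power_ideal_monomial_span[OF m U] monomial_span_power U
        up_closed_vimage_exponent_div exponent_power_vimage_div[OF m U]
        associated_primes_vimage_exponent_div[OF m up_closed_exponent_power[OF U]])
  \<comment> \<open>As the sets of associated primes agree for each \<open>s\<close>, both indices
    are \<open>LEAST\<close> of the same predicate.\<close>
  then show ?thesis
    by (simp add: index_of_stability_def)
qed

end
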